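(* Let $G$ be a graph with $\delta(G)\ge k\ge 1$. Then $d_{\times k,t}^{r}(G)=d_{\times k,t}(G)$.
   Context: All graphs are finite and simple; $N(x)$ denotes the open neighborhood of $x$ and $\delta$ the minimum degree. For an integer $k\ge 1$, a set $S\subseteq V(G)$ is a $k$-tuple total dominating set (kTDS) of $G$ if $|N(x)\cap S|\ge k$ for every $x\in V(G)$. A kTDS $S$ is a $k$-tuple total restrained dominating set (kTRDS) if moreover every vertex $x\in V(G)\setminus S$ is adjacent to at least $k$ vertices of $V(G)\setminus S$. $d_{\times k,t}(G)$ (the $k$-tuple total domatic number) is the maximum number of classes of a partition of $V(G)$ all of whose classes are kTDSs, and $d_{\times k,t}^{r}(G)$ (the $k$-tuple total restrained domatic number) is the maximum number of classes of a partition of $V(G)$ all of whose classes are kTRDSs. *)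

theory Defs
  imports "Graph_Theory.Pair_Digraph" "HOL-Library.Disjoint_Sets"
begin

text \<open>
  A finite simple graph is a \<^locale>\<open>pair_graph\<close>, that is, a finite loop-free digraph whose arc
  set is a symmetric set of pairs: the edge joining \<open>x\<close> and \<open>y\<close> is the pair of arcs \<open>(x, y)\<close>,
  \<open>(y, x)\<close>.
\<close>

definition open_nbhd :: "'a pair_pre_digraph \<Rightarrow> 'a \<Rightarrow> 'a set" where
  "open_nbhd G x = {y. (x, y) \<in> parcs G}"

text \<open>The minimum degree is unspecified (a minimum over the empty set) if \<open>G\<close> has no vertices.\<close>

definition min_degree :: "'a pair_pre_digraph \<Rightarrow> nat" where
  "min_degree G = Min ((\<lambda>x. card (open_nbhd G x)) ` pverts G)"

definition kTDS :: "nat \<Rightarrow> 'a pair_pre_digraph \<Rightarrow> 'a set \<Rightarrow> bool" where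
  "kTDS k G S \<longleftrightarrow> S \<subseteq> pverts G \<and> (\<forall>x\<in>pverts G. card (open_nbhd G x \<inter> S) \<ge> k)"

definition kTRDS :: "nat \<Rightarrow> 'a pair_pre_digraph \<Rightarrow> 'a set \<Rightarrow> bool" where
  "kTRDS k G S \<longleftrightarrow>
     kTDS k G S \<and> (\<forall>x\<in>pverts G - S. card (open_nbhd G x \<inter> (pverts G - S)) \<ge> k)"

text \<open>
  The maxima below range over finite sets because \<open>pverts G\<close> is finite. These sets are nonempty if
  the minimum degree is at least \<open>k\<close> and \<open>G\<close> has a vertex, as \<open>{pverts G}\<close> is then an admissible
  partition; if no admissible partition exists, the domatic numbers are unspecified.
\<close>

definition total_domatic :: "nat \<Rightarrow> 'a pair_pre_digraph \<Rightarrow> nat" where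
  "total_domatic k G = Max {card P | P. partition_on (pverts G) P \<and> (\<forall>S\<in>P. kTDS k G S)}"

definition total_restrained_domatic :: "nat \<Rightarrow> 'a pair_pre_digraph \<Rightarrow> nat" where
  "total_restrained_domatic k G =
     Max {card P | P. partition_on (pverts G) P \<and> (\<forall>S\<in>P. kTRDS k G S)}"

end

theory Submission
  imports Defs
begin

text \<open>
  A vertex \<open>x\<close> outside a class \<open>S\<close> of a partition into kTDSs lies in another class \<open>T\<close>, and its
  \<open>k\<close> neighbours in \<open>T\<close> all avoid \<open>S\<close>. Hence both domatic numbers maximise over the same
  partitions.
\<close>

lemma kTRDS_class_of_kTDS_partition:
  assumes "finite (pverts G)"
    and part: "partition_on (pverts G) P"
    and kTDS: "\<And>T. T \<in> P \<Longrightarrow> kTDS k G T"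
    and "S \<in> P"
  shows "kTRDS k G S"
  unfolding kTRDS_def
proof (intro conjI ballI)
  show "kTDS k G S"
    using kTDS \<open>S \<in> P\<close> .
next
  fix x assume x: "x \<in> pverts G - S"
  then obtain T where T: "T \<in> P" "x \<in> T"
    using partition_onD1[OF part] by blast
  \<comment> \<open>\<open>x\<close> lies in \<open>T\<close> but not in \<open>S\<close>, so these
    are distinct classes of the partition.\<close>
  then have "T \<inter> S = {}"
    using x \<open>S \<in> P\<close> partition_onD2[OF part] by (auto dest: disjointD)
  then have "T \<subseteq> pverts G - S"
    using T partition_onD1[OF part] by blast
  \<comment> \<open>\<open>card_mono\<close> needs the larger set to be finite; it is a subset of
    \<open>pverts G\<close>.\<close>
  then have "card (open_nbhd G x \<inter> T) \<le> card (open_nbhd G x \<inter> (pverts G - S))"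
    using assms(1) by (intro card_mono) auto
  moreover have "k \<le> card (open_nbhd G x \<inter> T)"
    using kTDS[OF T(1)] x by (simp add: kTDS_def)
  ultimately show "k \<le> card (open_nbhd G x \<inter> (pverts G - S))"
    by linarith
qed

theorem theorem4p4:
  fixes G :: "'a pair_pre_digraph" and k :: nat
  assumes "pair_graph G"
    and "k \<ge> 1"
    and "min_degree G \<ge> k"
  shows "total_restrained_domatic k G = total_domatic k G"
proof -
  interpret pair_graph G by fact
  \<comment> \<open>Proved for each \<open>P\<close> separately, so that both \<open>Max\<close>
    terms range over the same set of cardinalities. From left to right it is the definition of
    \<open>kTRDS\<close>; the converse is the lemma.\<close>
  have "(partition_on (pverts G) P \<and> (\<forall>S\<in>P. kTRDS k G S)) \<longleftrightarrow>
      (partition_on (pverts G) P \<and> (\<forall>S\<in>P. kTDS k G S))" for P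
    using kTRDS_class_of_kTDS_partition[OF pair_finite_verts] by (auto simp: kTRDS_def)
  then show ?thesis
    by (simp add: total_restrained_domatic_def total_domatic_def)
qed

end
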